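(* Let $k\ge 3$ and let $F$ be a $k$-graph. Suppose that there exist $r\in\mathbb N$ and a set $\mathscr P\subseteq [r]^{k}$ (the set of $k$-tuples with entries in $[r]=\{1,\dots,r\}$) with the following property: for every $n\in\mathbb N$ and every map $\psi:\binom{[n]}{k-1}\to[r]$ (defined on the $(k-1)$-element subsets of $[n]$), the $k$-graph $H$ with vertex set $[n]$ and edge set \[ E(H)=\Big\{e=\{i_1<i_2<\dots<i_k\}\subseteq[n]:\ \big(\psi(e\setminus\{i_1\}),\psi(e\setminus\{i_2\}),\dots,\psi(e\setminus\{i_k\})\big)\in\mathscr P\Big\} \] is $F$-free. Then $\pi_{k-2}(F)\ge |\mathscr P|/r^k$.
   Context: A $k$-graph is a pair $H=(V,E)$ with $E$ a set of $k$-element subsets of the finite set $V$; $H$ is $F$-free if it contains no subhypergraph isomorphic to $F$. For an integer $0\le j<k$ and a $j$-graph $G$ on vertex set $V$, let $\mathcal K_k(G)$ denote the set of $k$-subsets of $V$ all of whose $j$-subsets are edges of $G$ (for $j=0$ there are two $0$-graphs: with empty edge set, or with the empty set as an edge). Given $d\in[0,1]$ and $\mu>0$, a $k$-graph $H=(V,E)$ with $n$ vertices is $(d,\mu,j)$-dense if $|\mathcal K_k(G)\cap E|\ge d|\mathcal K_k(G)|-\mu n^k$ for every $j$-graph $G$ with vertex set $V$. For a $k$-graph $F$, $\pi_j(F)$ is the supremum of all $d\in[0,1]$ such that for every $\mu>0$ and every $n_0\in\mathbb N$ there exists an $F$-free $(d,\mu,j)$-dense $k$-graph $H$ with at least $n_0$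 vertices. *)

theory Defs
  imports Complex_Main "HOL-Library.Ramsey" "HOL-Library.FuncSet"
begin

type_synonym 'a hypergraph = "'a set \<times> 'a set set"

abbreviation verts :: "'a hypergraph \<Rightarrow> 'a set" where
  "verts H \<equiv> fst H"

abbreviation edges :: "'a hypergraph \<Rightarrow> 'a set set" where
  "edges H \<equiv> snd H"

definition kgraph :: "nat \<Rightarrow> 'a hypergraph \<Rightarrow> bool" where
  "kgraph k H \<longleftrightarrow> finite (verts H) \<and> edges H \<subseteq> nsets (verts H) k"

definition subhypergraph :: "nat \<Rightarrow> 'a hypergraph \<Rightarrow> 'a hypergraph \<Rightarrow> bool" where
  "subhypergraph k H' H \<longleftrightarrow>
     kgraph k H' \<and> verts H' \<subseteq> verts H \<and> edges H' \<subseteq> edges H"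

definition isomorphic :: "'a hypergraph \<Rightarrow> 'b hypergraph \<Rightarrow> bool" where
  "isomorphic F H \<longleftrightarrow>
     (\<exists>f. bij_betw f (verts F) (verts H) \<and> edges H = (\<lambda>e. f ` e) ` edges F)"

definition free_of :: "nat \<Rightarrow> 'a hypergraph \<Rightarrow> 'b hypergraph \<Rightarrow> bool" where
  "free_of k F H \<longleftrightarrow> \<not> (\<exists>H'. subhypergraph k H' H \<and> isomorphic F H')"

definition cliques :: "nat \<Rightarrow> nat \<Rightarrow> 'a hypergraph \<Rightarrow> 'a set set" where
  "cliques k j G = {S \<in> nsets (verts G) k. nsets S j \<subseteq> edges G}"

definition dense :: "nat \<Rightarrow> real \<Rightarrow> real \<Rightarrow> nat \<Rightarrow> 'a hypergraph \<Rightarrow> bool" where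
  "dense k d \<mu> j H \<longleftrightarrow>
     (\<forall>G. kgraph j G \<and> verts G = verts H \<longrightarrow>
        real (card (cliques k j G \<inter> edges H))
          \<ge> d * real (card (cliques k j G)) - \<mu> * real (card (verts H)) ^ k)"

text \<open>The host hypergraphs range over finite sets of natural numbers; up to isomorphism these are
  all finite hypergraphs. The set below is empty (and the supremum then unspecified) exactly when
  \<open>F\<close> has no edges.\<close>

definition uniform_turan_density :: "nat \<Rightarrow> nat \<Rightarrow> 'a hypergraph \<Rightarrow> real" where
  "uniform_turan_density k j F =
     Sup {d. 0 \<le> d \<and> d \<le> 1 \<and>
       (\<forall>\<mu>>0. \<forall>n\<^sub>0. \<exists>H :: nat hypergraph.
          kgraph k H \<and> card (verts H) \<ge> n\<^sub>0 \<and> free_of k F H \<and> dense k d \<mu> j H)}"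

definition palette_hypergraph ::
    "nat \<Rightarrow> nat list set \<Rightarrow> nat \<Rightarrow> (nat set \<Rightarrow> nat) \<Rightarrow> nat hypergraph" where
  "palette_hypergraph k P n \<psi> =
     ({1..n}, {e \<in> nsets {1..n} k. map (\<lambda>i. \<psi> (e - {i})) (sorted_list_of_set e) \<in> P})"

end

theory Submission
  imports Defs
begin

text \<open>Colour the \<open>(k - 1)\<close>-subsets of \<open>{1..n}\<close> uniformly and independently at random. For a fixed
  \<open>(k - 2)\<close>-graph \<open>G\<close> the number of edges of the palette hypergraph among the \<open>k\<close>-cliques of \<open>G\<close> has
  mean \<open>|P| / r ^ k\<close> times the number of cliques, because the \<open>k\<close> colours seen by a \<open>k\<close>-set are
  independent. Recolouring one \<open>(k - 1)\<close>-set changes this number by at most \<open>n\<close>, so by the bounded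
  differences inequality it falls short of its mean by \<open>\<mu> n ^ k\<close> with probability at most
  \<open>exp (- \<mu>\<^sup>2 n ^ (k - 1) / 4)\<close>. This beats the at most \<open>2 ^ (n ^ (k - 2))\<close> choices of \<open>G\<close>
  once \<open>n\<close> is large. Probabilities appear as cardinalities of sets of colourings in \<open>PiE\<close>.\<close>

section \<open>Bounded differences on finite product spaces\<close>

lemma sum_PiE_insert:
  assumes "x \<notin> A"
  shows "(\<Sum>h\<in>PiE (insert x A) (\<lambda>_. C). f h) = (\<Sum>g\<in>PiE A (\<lambda>_. C). \<Sum>y\<in>C. f (g(x := y)))"
proof -
  have "(\<Sum>h\<in>PiE (insert x A) (\<lambda>_. C). f h)
      = (\<Sum>(y, g)\<in>C \<times> PiE A (\<lambda>_. C). f (g(x := y)))"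
    using inj_combinator[OF assms, of "\<lambda>_. C"]
    by (simp add: PiE_insert_eq sum.reindex case_prod_unfold)
  also have "\<dots> = (\<Sum>g\<in>PiE A (\<lambda>_. C). \<Sum>y\<in>C. f (g(x := y)))"
    by (subst sum.cartesian_product[symmetric], rule sum.swap)
  finally show ?thesis .
qed

text \<open>For \<open>y < 0\<close> put \<open>t = - y\<close>. Then
  \<open>1 \<le> 1 + t ^ 3 = (1 + t) * (1 - t + t\<^sup>2)\<close>, where
  \<open>1 + t \<le> exp t\<close>; multiplying by \<open>exp (- t)\<close> gives the claim.\<close>

lemma exp_le_quadratic:
  fixes y :: real
  assumes "\<bar>y\<bar> \<le> 1"
  shows "exp y \<le> 1 + y + y\<^sup>2"
proof (cases "y \<ge> 0")
  case True
  then show ?thesis using assms exp_bound by simp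
next
  case False
  define t where "t = - y"
  have t: "t > 0" using False by (simp add: t_def)
  have "1 \<le> 1 + t ^ 3" using t by simp
  also have "\<dots> = (1 + t) * (1 - t + t\<^sup>2)"
    by (simp add: algebra_simps power2_eq_square power3_eq_cube)
  also have "\<dots> \<le> exp t * (1 - t + t\<^sup>2)"
  proof (rule mult_right_mono)
    have "0 \<le> (1 - t)\<^sup>2 + t" using t by simp
    then show "0 \<le> 1 - t + t\<^sup>2"
      using t by (simp add: power2_diff)
  qed (rule exp_ge_add_one_self)
  finally have "exp (- t) * 1 \<le> exp (- t) * (exp t * (1 - t + t\<^sup>2))"
    by (intro mult_left_mono) auto
  also have "\<dots> = 1 - t + t\<^sup>2"
    by (simp flip: exp_add mult.assoc)
  finally show ?thesis by (simp add: t_def)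
qed

text \<open>A form of Hoeffding's lemma: the linear terms cancel because \<open>u\<close> is
  centred, and the quadratic terms are absorbed by \<open>1 + z \<le> exp z\<close>.\<close>

lemma sum_exp_centered_le:
  fixes u :: "'c \<Rightarrow> real"
  assumes "finite C" "(\<Sum>y\<in>C. u y) = 0" "\<And>y. y \<in> C \<Longrightarrow> \<bar>u y\<bar> \<le> b" "\<bar>s\<bar> * b \<le> 1"
  shows "(\<Sum>y\<in>C. exp (s * u y)) \<le> card C * exp (s\<^sup>2 * b\<^sup>2)"
proof -
  have "exp (s * u y) \<le> s * u y + exp (s\<^sup>2 * b\<^sup>2)" if "y \<in> C" for y
  proof -
    have u: "\<bar>u y\<bar> \<le> b" using assms that by blast
    have "\<bar>s * u y\<bar> \<le> \<bar>s\<bar> * b" using u by (simp add: abs_mult mult_left_mono)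
    then have "exp (s * u y) \<le> 1 + s * u y + (s * u y)\<^sup>2"
      using assms(4) by (intro exp_le_quadratic) linarith
    moreover have "(s * u y)\<^sup>2 \<le> s\<^sup>2 * b\<^sup>2"
      using u abs_le_square_iff[of "u y" b] by (simp add: power_mult_distrib mult_left_mono)
    ultimately show ?thesis
      using exp_ge_add_one_self[of "s\<^sup>2 * b\<^sup>2"] by linarith
  qed
  then have "(\<Sum>y\<in>C. exp (s * u y)) \<le> (\<Sum>y\<in>C. s * u y + exp (s\<^sup>2 * b\<^sup>2))"
    by (rule sum_mono)
  also have "\<dots> = card C * exp (s\<^sup>2 * b\<^sup>2)"
    using assms(2) by (simp add: sum.distrib flip: sum_distrib_left)
  finally show ?thesis .
qed

text \<open>McDiarmid's argument with the Doob martingale unfolded into an induction over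
  coordinates: each one contributes a factor \<open>exp (s\<^sup>2 * b\<^sup>2)\<close> to the
  average of \<open>exp (s * (f g - m))\<close>.\<close>

lemma bounded_differences_mgf:
  fixes f :: "('i \<Rightarrow> 'c) \<Rightarrow> real"
  assumes "finite A" "finite C" "C \<noteq> {}" "\<bar>s\<bar> * b \<le> 1"
    and "\<And>g x y. \<lbrakk>g \<in> PiE A (\<lambda>_. C); x \<in> A; y \<in> C\<rbrakk> \<Longrightarrow> \<bar>f (g(x := y)) - f g\<bar> \<le> b"
    and "(\<Sum>g\<in>PiE A (\<lambda>_. C). f g) = m * real (card C) ^ card A"
  shows "(\<Sum>g\<in>PiE A (\<lambda>_. C). exp (s * (f g - m)))
           \<le> real (card C) ^ card A * exp (s\<^sup>2 * b\<^sup>2 * card A)"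
  using assms(1,5,6)
proof (induction A arbitrary: f rule: finite_induct)
  case empty
  then show ?case by simp
next
  case (insert x A)
  define q where "q = real (card C)"
  have q: "q > 0" using assms(2,3) by (simp add: q_def card_gt_0_iff)
  \<comment> \<open>\<open>F\<close> averages out the coordinate \<open>x\<close>; it again has differences at most \<open>b\<close>, and given the other
    coordinates \<open>f - F\<close> is centred and bounded by \<open>b\<close>.\<close>
  define F where "F g = (\<Sum>y\<in>C. f (g(x := y))) / q" for g
  have upd: "g(x := y) \<in> PiE (insert x A) (\<lambda>_. C)" if "g \<in> PiE A (\<lambda>_. C)" "y \<in> C" for g y
    using that by (auto simp: PiE_def extensional_def)
  have avg: "\<bar>(\<Sum>y\<in>C. v y) / q\<bar> \<le> b" if "\<And>y. y \<in> C \<Longrightarrow> \<bar>v y\<bar> \<le> b" for v :: "'c \<Rightarrow> real"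
  proof -
    have "\<bar>\<Sum>y\<in>C. v y\<bar> \<le> (\<Sum>y\<in>C. \<bar>v y\<bar>)" by (rule sum_abs)
    also have "\<dots> \<le> q * b"
      using sum_bounded_above[of C "\<lambda>y. \<bar>v y\<bar>" b] that by (simp add: q_def)
    finally have "\<bar>\<Sum>y\<in>C. v y\<bar> / q \<le> b" using q by (simp add: pos_divide_le_eq mult.commute)
    then show ?thesis using q by simp
  qed
  have F_diff: "\<bar>F (g(z := c)) - F g\<bar> \<le> b" if "g \<in> PiE A (\<lambda>_. C)" "z \<in> A" "c \<in> C" for g z c
  proof -
    have "z \<noteq> x" using that insert.hyps by blast
    then have eq: "F (g(z := c)) - F g = (\<Sum>y\<in>C. f ((g(x := y))(z := c)) - f (g(x := y))) / q"
      by (simp add: F_def sum_subtractf diff_divide_distrib fun_upd_twist)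
    show ?thesis
      unfolding eq
    proof (rule avg)
      fix v assume v: "v \<in> C"
      show "\<bar>f ((g(x := v))(z := c)) - f (g(x := v))\<bar> \<le> b"
        by (rule insert.prems(1)[OF upd]) (use that v in simp_all)
    qed
  qed
  have f_diff: "\<bar>f (g(x := y)) - F g\<bar> \<le> b" if "g \<in> PiE A (\<lambda>_. C)" "y \<in> C" for g y
  proof -
    \<comment> \<open>\<open>g\<close> itself need not lie in the larger product, so
      \<open>f (g(x := y))\<close> is rewritten as a single change starting from each
      \<open>g(x := c)\<close>, which does.\<close>
    have eq: "f (g(x := y)) - F g = (\<Sum>c\<in>C. f ((g(x := c))(x := y)) - f (g(x := c))) / q"
      using q by (simp add: F_def sum_subtractf diff_divide_distrib q_def)
    show ?thesis
      unfolding eq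
    proof (rule avg)
      fix v assume v: "v \<in> C"
      show "\<bar>f ((g(x := v))(x := y)) - f (g(x := v))\<bar> \<le> b"
        by (rule insert.prems(1)[OF upd]) (use that v in simp_all)
    qed
  qed
  have f_mean: "(\<Sum>y\<in>C. f (g(x := y)) - F g) = 0" for g
    using q by (simp add: F_def sum_subtractf q_def)
  have F_sum: "(\<Sum>g\<in>PiE A (\<lambda>_. C). F g) = m * real (card C) ^ card A"
    using insert.prems(2) insert.hyps q
    by (simp add: F_def sum_PiE_insert flip: sum_divide_distrib q_def)
  \<comment> \<open>Split \<open>f - m\<close> as \<open>(F - m) + (f - F)\<close>: the first factor
    is constant in the new coordinate, and the inner sum over that coordinate is centred.\<close>
  have "(\<Sum>h\<in>PiE (insert x A) (\<lambda>_. C). exp (s * (f h - m)))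
      = (\<Sum>g\<in>PiE A (\<lambda>_. C). exp (s * (F g - m)) * (\<Sum>y\<in>C. exp (s * (f (g(x := y)) - F g))))"
    using insert.hyps
    by (simp add: sum_PiE_insert sum_distrib_left algebra_simps flip: exp_add)
  also have "\<dots> \<le> (\<Sum>g\<in>PiE A (\<lambda>_. C). exp (s * (F g - m)) * (q * exp (s\<^sup>2 * b\<^sup>2)))"
    using sum_exp_centered_le[OF assms(2) f_mean f_diff assms(4)]
    by (intro sum_mono mult_left_mono) (auto simp: q_def)
  also have "\<dots> \<le> (q ^ card A * exp (s\<^sup>2 * b\<^sup>2 * card A)) * (q * exp (s\<^sup>2 * b\<^sup>2))"
    using insert.IH[OF F_diff F_sum] q
    by (subst sum_distrib_right[symmetric], intro mult_right_mono) (auto simp: q_def)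
  also have "\<dots> = q ^ card (insert x A) * exp (s\<^sup>2 * b\<^sup>2 * card (insert x A))"
    using insert.hyps by (simp add: algebra_simps exp_add)
  finally show ?case by (simp add: q_def)
qed

text \<open>Chernoff's method: Markov's inequality for \<open>exp (- s * (f g - m))\<close>, with
  the exponential moment bounded at \<open>- s\<close>.\<close>

lemma bounded_differences_lower_tail:
  fixes f :: "('i \<Rightarrow> 'c) \<Rightarrow> real"
  assumes "finite A" "finite C" "C \<noteq> {}" "0 \<le> s" "s * b \<le> 1"
    and "\<And>g x y. \<lbrakk>g \<in> PiE A (\<lambda>_. C); x \<in> A; y \<in> C\<rbrakk> \<Longrightarrow> \<bar>f (g(x := y)) - f g\<bar> \<le> b"
    and "(\<Sum>g\<in>PiE A (\<lambda>_. C). f g) = m * real (card C) ^ card A"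
  shows "real (card {g \<in> PiE A (\<lambda>_. C). f g < m - t})
           \<le> real (card C) ^ card A * exp (s\<^sup>2 * b\<^sup>2 * card A - s * t)"
proof -
  let ?B = "{g \<in> PiE A (\<lambda>_. C). f g < m - t}"
  have fin: "finite (PiE A (\<lambda>_. C))" using assms by (simp add: finite_PiE)
  have "card ?B * exp (s * t) = (\<Sum>g\<in>?B. exp (s * t))" by simp
  also have "\<dots> \<le> (\<Sum>g\<in>?B. exp (- s * (f g - m)))"
  proof (rule sum_mono)
    fix g assume "g \<in> ?B"
    then have "s * t \<le> s * (m - f g)" using assms(4) by (intro mult_left_mono) auto
    then show "exp (s * t) \<le> exp (- s * (f g - m))" by (simp add: algebra_simps)
  qed
  also have "\<dots> \<le> (\<Sum>g\<in>PiE A (\<lambda>_. C). exp (- s * (f g - m)))"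
    using fin by (intro sum_mono2) auto
  also have "\<dots> \<le> real (card C) ^ card A * exp ((- s)\<^sup>2 * b\<^sup>2 * card A)"
    using assms by (intro bounded_differences_mgf) auto
  finally show ?thesis by (simp add: exp_diff field_simps)
qed

section \<open>Independence of the values at distinct coordinates\<close>

text \<open>The coordinates outside \<open>D\<close> remain free. The power for \<open>D\<close> is
  multiplied across so that no truncated subtraction occurs in an exponent.\<close>

lemma card_PiE_prescribed:
  assumes "finite A" "finite C" "distinct D" "set D \<subseteq> A" "length xs = length D" "set xs \<subseteq> C"
  shows "card {g \<in> PiE A (\<lambda>_. C). map g D = xs} * card C ^ length D = card C ^ card A"
proof -
  \<comment> \<open>The constrained functions again form a product, with singleton factors on
    \<open>D\<close>; as \<open>D\<close> is distinct, the lookup returns the matching entry of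
    \<open>xs\<close>.\<close>
  define T where "T a = (if a \<in> set D then {the (map_of (zip D xs) a)} else C)" for a
  have nth: "the (map_of (zip D xs) (D ! i)) = xs ! i" if "i < length D" for i
    using that assms by (simp add: map_of_zip_nth)
  have "{g \<in> PiE A (\<lambda>_. C). map g D = xs} = PiE A T"
  proof (intro set_eqI iffI)
    fix g assume g: "g \<in> {g \<in> PiE A (\<lambda>_. C). map g D = xs}"
    then have "g a = the (map_of (zip D xs) a)" if "a \<in> set D" for a
      using that nth by (auto simp: in_set_conv_nth)
    then show "g \<in> PiE A T" using g by (auto simp: T_def PiE_iff)
  next
    fix g assume g: "g \<in> PiE A T"
    have eq: "g (D ! i) = xs ! i" if "i < length D" for i
    proof -
      have "D ! i \<in> A" using that assms(4) nth_mem by blast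
      then have "g (D ! i) \<in> T (D ! i)" using g by blast
      then show ?thesis using that nth by (simp add: T_def)
    qed
    have "g a \<in> C" if "a \<in> A" for a
    proof (cases "a \<in> set D")
      case True
      then obtain i where "i < length D" "a = D ! i" by (auto simp: in_set_conv_nth)
      then show ?thesis using eq assms(5,6) nth_mem by fastforce
    next
      case False
      then show ?thesis using g that by (auto simp: T_def PiE_iff)
    qed
    moreover have "map g D = xs" using eq assms(5) by (intro nth_equalityI) auto
    ultimately show "g \<in> {g \<in> PiE A (\<lambda>_. C). map g D = xs}" using g by (auto simp: PiE_iff)
  qed
  then have "card {g \<in> PiE A (\<lambda>_. C). map g D = xs} = (\<Prod>a\<in>A. card (T a))"
    using assms(1) by (simp add: card_PiE)
  also have "\<dots> = (\<Prod>a\<in>A. if a \<in> set D then 1 else card C)"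
    by (intro prod.cong) (auto simp: T_def)
  also have "\<dots> = card C ^ card (A - set D)"
    using assms(1) by (simp add: prod.If_cases Diff_eq)
  finally show ?thesis
    using assms by (simp add: card_Diff_subset distinct_card card_mono flip: power_add)
      (metis distinct_card card_mono le_add_diff_inverse2)
qed

text \<open>The values along \<open>D\<close> are uniform on lists over \<open>C\<close>: the
  colourings split disjointly by their list of values, and each list in \<open>P\<close> accounts
  for equally many.\<close>

lemma card_PiE_pattern:
  assumes "finite A" "finite C" "distinct D" "set D \<subseteq> A"
    and "P \<subseteq> {xs. length xs = length D \<and> set xs \<subseteq> C}"
  shows "card {g \<in> PiE A (\<lambda>_. C). map g D \<in> P} * card C ^ length D = card P * card C ^ card A"
proof -
  have finP: "finite P"
    using assms(2,5) finite_lists_length_eq[OF assms(2), of "length D"]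
    by (elim finite_subset[rotated]) (auto simp: conj_commute)
  have "{g \<in> PiE A (\<lambda>_. C). map g D \<in> P} = (\<Union>xs\<in>P. {g \<in> PiE A (\<lambda>_. C). map g D = xs})"
    by auto
  also have "card \<dots> = (\<Sum>xs\<in>P. card {g \<in> PiE A (\<lambda>_. C). map g D = xs})"
    using finP assms(1,2) by (intro card_UN_disjoint) (auto simp: finite_PiE)
  finally have "card {g \<in> PiE A (\<lambda>_. C). map g D \<in> P} * card C ^ length D
      = (\<Sum>xs\<in>P. card {g \<in> PiE A (\<lambda>_. C). map g D = xs} * card C ^ length D)"
    by (simp add: sum_distrib_right)
  also have "\<dots> = (\<Sum>xs\<in>P. card C ^ card A)"
    using assms by (intro sum.cong card_PiE_prescribed) auto
  finally show ?thesis by simp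
qed

section \<open>Edge counts of random palette hypergraphs\<close>

text \<open>Kept apart from the colouring so that the pattern seen by \<open>e\<close> is
  \<open>map \<psi> (deletions e)\<close>, the values of \<open>\<psi>\<close> along a list of
  coordinates.\<close>

definition deletions :: "nat set \<Rightarrow> nat set list" where
  "deletions e = map (\<lambda>i. e - {i}) (sorted_list_of_set e)"

lemma deletions_props:
  assumes "e \<in> nsets {1..n} k"
  shows "distinct (deletions e)" "length (deletions e) = k"
    "set (deletions e) \<subseteq> nsets {1..n} (k - 1)"
    "\<And>x. x \<in> set (deletions e) \<Longrightarrow> \<exists>i\<in>{1..n}. e = insert i x"
proof -
  have e: "e \<subseteq> {1..n}" "finite e" "card e = k" using assms by (auto simp: nsets_def)
  show "distinct (deletions e)"
    using e by (auto simp: deletions_def distinct_map inj_on_def)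
  show "length (deletions e) = k" using e by (simp add: deletions_def)
  show "set (deletions e) \<subseteq> nsets {1..n} (k - 1)"
    using e by (auto simp: deletions_def nsets_def)
  show "\<exists>i\<in>{1..n}. e = insert i x" if "x \<in> set (deletions e)" for x
    using e that by (auto simp: deletions_def)
qed

lemma edges_palette_hypergraph:
  "edges (palette_hypergraph k P n \<psi>) = {e \<in> nsets {1..n} k. map \<psi> (deletions e) \<in> P}"
  by (simp add: palette_hypergraph_def deletions_def o_def)

text \<open>Recolouring \<open>x\<close> affects only those \<open>e\<close> that have
  \<open>x\<close> among their deletions. Such an \<open>e\<close> is \<open>insert i x\<close> for
  some \<open>i\<close> in \<open>{1..n}\<close>, so there are at most \<open>n\<close> of
  them.\<close>

lemma palette_edge_count_diff:
  assumes "K \<subseteq> nsets {1..n} k"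
  shows "\<bar>real (card (K \<inter> edges (palette_hypergraph k P n (g(x := c)))))
        - real (card (K \<inter> edges (palette_hypergraph k P n g)))\<bar> \<le> real n"
proof -
  let ?E = "\<lambda>g. K \<inter> edges (palette_hypergraph k P n g)"
  let ?I = "(\<lambda>i. insert i x) ` {1..n}"
  have finK: "finite K" using assms finite_subset finite_imp_finite_nsets by blast
  have mem: "e \<in> ?I" if "e \<in> K" "map (g(x := c)) (deletions e) \<noteq> map g (deletions e)" for e
  proof -
    have "x \<in> set (deletions e)" using that(2) by (metis fun_upd_other map_ext)
    then show ?thesis using deletions_props(4) that(1) assms by blast
  qed
  have I: "card ?I \<le> n" using card_image_le[of "{1..n}"] by simp
  have le: "card U \<le> card V + n" if "U \<subseteq> V \<union> ?I" "finite V" for U V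
  proof -
    have "card U \<le> card (V \<union> ?I)" using that by (intro card_mono) auto
    also have "\<dots> \<le> card V + card ?I" by (rule card_Un_le)
    finally show ?thesis using I by linarith
  qed
  have sub: "?E g1 \<subseteq> ?E g2 \<union> ?I"
    if "\<And>e. \<lbrakk>e \<in> K; map g1 (deletions e) \<noteq> map g2 (deletions e)\<rbrakk> \<Longrightarrow> e \<in> ?I" for g1 g2
  proof
    fix e assume e: "e \<in> ?E g1"
    show "e \<in> ?E g2 \<union> ?I"
    proof (cases "map g1 (deletions e) = map g2 (deletions e)")
      case True
      then show ?thesis using e unfolding edges_palette_hypergraph by (simp del: map_eq_conv)
    next
      case False
      then show ?thesis using e that by blast
    qed
  qed
  have "?E (g(x := c)) \<subseteq> ?E g \<union> ?I" "?E g \<subseteq> ?E (g(x := c)) \<union> ?I"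
    using mem by (intro sub; metis)+
  then have "card (?E (g(x := c))) \<le> card (?E g) + n" "card (?E g) \<le> card (?E (g(x := c))) + n"
    using finK le by blast+
  then show ?thesis by linarith
qed

text \<open>Linearity of expectation: after exchanging the sums, each \<open>e\<close> in
  \<open>K\<close> contributes the same amount, since its \<open>k\<close> deletions are distinct
  coordinates.\<close>

lemma palette_edge_count_sum:
  assumes "K \<subseteq> nsets {1..n} k" "r \<ge> 1" "P \<subseteq> {xs. length xs = k \<and> set xs \<subseteq> {1..r}}"
  defines "A \<equiv> nsets {1..n} (k - 1)"
  shows "(\<Sum>g\<in>PiE A (\<lambda>_. {1..r}). real (card (K \<inter> edges (palette_hypergraph k P n g))))
       = (real (card P) / real r ^ k * real (card K)) * real r ^ card A"
proof -
  let ?\<Omega> = "PiE A (\<lambda>_. {1..r})"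
  have finA: "finite A" by (simp add: A_def finite_imp_finite_nsets)
  have finK: "finite K" using assms finite_subset finite_imp_finite_nsets by blast
  have fin: "finite ?\<Omega>" using finA by (simp add: finite_PiE)
  have "(\<Sum>g\<in>?\<Omega>. real (card (K \<inter> edges (palette_hypergraph k P n g))))
      = (\<Sum>g\<in>?\<Omega>. \<Sum>e\<in>K. if map g (deletions e) \<in> P then 1 else 0)"
  proof (rule sum.cong)
    fix g
    have "K \<inter> edges (palette_hypergraph k P n g) = K \<inter> {e. map g (deletions e) \<in> P}"
      using assms(1) by (auto simp: edges_palette_hypergraph)
    then show "real (card (K \<inter> edges (palette_hypergraph k P n g)))
        = (\<Sum>e\<in>K. if map g (deletions e) \<in> P then 1 else 0)"
      using finK by (simp add: sum.If_cases)
  qed simp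
  also have "\<dots> = (\<Sum>e\<in>K. \<Sum>g\<in>?\<Omega>. if map g (deletions e) \<in> P then 1 else 0)"
    by (rule sum.swap)
  also have "\<dots> = (\<Sum>e\<in>K. real (card P) / real r ^ k * real r ^ card A)"
  proof (rule sum.cong)
    fix e assume "e \<in> K"
    then have e: "e \<in> nsets {1..n} k" using assms(1) by blast
    have "card {g \<in> ?\<Omega>. map g (deletions e) \<in> P} * card {1..r} ^ length (deletions e)
        = card P * card {1..r} ^ card A"
      using deletions_props[OF e] assms(3) finA by (intro card_PiE_pattern) (auto simp: A_def)
    then have "card {g \<in> ?\<Omega>. map g (deletions e) \<in> P} * r ^ k = card P * r ^ card A"
      using deletions_props(2)[OF e] by simp
    from arg_cong[OF this, of real]
    have "real (card {g \<in> ?\<Omega>. map g (deletions e) \<in> P}) * real r ^ k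
        = real (card P) * real r ^ card A"
      by simp
    then show "(\<Sum>g\<in>?\<Omega>. if map g (deletions e) \<in> P then 1 else 0)
        = real (card P) / real r ^ k * real r ^ card A"
      using fin assms(2) by (simp add: sum.If_cases Int_def field_simps)
  qed simp
  finally show ?thesis by simp
qed

lemma card_nsets_le_power: "card (nsets {1..n} j) \<le> n ^ j"
  by (cases "j \<le> n") (auto simp: binomial_le_pow binomial_eq_0)

section \<open>Union bound over all clique sets\<close>

text \<open>The bound on \<open>n\<close> makes the exponent of the union bound negative;
  \<open>\<mu> \<le> 1\<close> keeps the Chernoff parameter in its admissible range.\<close>

lemma exists_dense_palette_hypergraph:
  assumes "k \<ge> 2" "r \<ge> 1" "P \<subseteq> {xs. length xs = k \<and> set xs \<subseteq> {1..r}}"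
    and "0 < \<mu>" "\<mu> \<le> 1" "real n > 4 / \<mu>\<^sup>2"
  obtains \<psi> where "\<psi> \<in> nsets {1..n} (k - 1) \<rightarrow> {1..r}"
    and "dense k (real (card P) / real r ^ k) \<mu> (k - 2) (palette_hypergraph k P n \<psi>)"
proof -
  define A where "A = nsets {1..n} (k - 1)"
  define d where "d = real (card P) / real r ^ k"
  define t where "t = \<mu> * real n ^ k"
  let ?\<Omega> = "PiE A (\<lambda>_. {1..r})"
  define X where "X K g = real (card (K \<inter> edges (palette_hypergraph k P n g)))" for K g
  \<comment> \<open>The density condition sees a graph only through its set of cliques, so the union
    bound runs over these sets; there are at most as many as graphs.\<close>
  define \<K> where "\<K> = (\<lambda>E. cliques k (k - 2) ({1..n}, E)) ` Pow (nsets {1..n} (k - 2))"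
  define B where "B K = {g \<in> ?\<Omega>. X K g < d * real (card K) - t}" for K
  have "4 / \<mu>\<^sup>2 > 0" using assms(4) by simp
  then have n: "n > 0" using assms(6) by (cases n) auto
  have finA: "finite A" by (simp add: A_def finite_imp_finite_nsets)
  have fin: "finite ?\<Omega>" using finA by (simp add: finite_PiE)
  have fin\<K>: "finite \<K>" by (simp add: \<K>_def finite_imp_finite_nsets)
  have \<K>_sub: "K \<subseteq> nsets {1..n} k" if "K \<in> \<K>" for K
    using that by (auto simp: \<K>_def cliques_def)
  have "card \<K> \<le> card (Pow (nsets {1..n} (k - 2)))"
    unfolding \<K>_def by (intro card_image_le) (simp add: finite_imp_finite_nsets)
  also have "\<dots> \<le> 2 ^ (n ^ (k - 2))"
    by (simp only: card_Pow finite_imp_finite_nsets finite_atLeastAtMost power_increasing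
        card_nsets_le_power one_le_numeral)
  finally have "real (card \<K>) \<le> 2 ^ (n ^ (k - 2))"
    by (metis of_nat_le_iff of_nat_numeral of_nat_power)
  also have "\<dots> \<le> exp 1 ^ (n ^ (k - 2))"
    using exp_ge_add_one_self[of 1] by (intro power_mono) auto
  also have "\<dots> = exp (real n ^ (k - 2))" by (simp flip: exp_of_nat_mult)
  finally have card\<K>: "real (card \<K>) \<le> exp (real n ^ (k - 2))" .
  have B: "real (card (B K)) \<le> real r ^ card A * exp (- \<mu>\<^sup>2 / 4 * real n ^ (k - 1))"
    if "K \<in> \<K>" for K
  proof -
    \<comment> \<open>The choice \<open>s = \<mu> / (2 * real n)\<close> minimises
      \<open>s\<^sup>2 * n\<^sup>2 * card A - s * t\<close> once \<open>card A\<close> is replaced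
      by its upper bound \<open>n ^ (k - 1)\<close>.\<close>
    have "\<mu> / (2 * real n) * real n \<le> 1" using n assms(5) by simp
    then have "real (card (B K)) \<le> real (card {1..r}) ^ card A
        * exp ((\<mu> / (2 * real n))\<^sup>2 * (real n)\<^sup>2 * card A - \<mu> / (2 * real n) * t)"
      unfolding B_def
    proof (intro bounded_differences_lower_tail)
      show "(\<Sum>g\<in>?\<Omega>. X K g) = d * real (card K) * real (card {1..r}) ^ card A"
        using palette_edge_count_sum[OF \<K>_sub[OF that] assms(2,3)]
        by (simp only: X_def d_def A_def card_atLeastAtMost diff_Suc_1)
      show "\<bar>X K (g(x := y)) - X K g\<bar> \<le> real n" for g x y
        unfolding X_def by (rule palette_edge_count_diff[OF \<K>_sub[OF that]])
    qed (use finA assms(2,4) in auto)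
    also have "(\<mu> / (2 * real n))\<^sup>2 * (real n)\<^sup>2 * card A - \<mu> / (2 * real n) * t
        = \<mu>\<^sup>2 / 4 * card A - \<mu>\<^sup>2 / 2 * real n ^ (k - 1)"
    proof -
      have "real n ^ k = real n * real n ^ (k - 1)" using assms(1) by (simp flip: power_Suc)
      then show ?thesis using n by (simp add: t_def power2_eq_square field_simps)
    qed
    also have "\<dots> \<le> - \<mu>\<^sup>2 / 4 * real n ^ (k - 1)"
    proof -
      have "real (card A) \<le> real n ^ (k - 1)"
        using card_nsets_le_power[of n "k - 1"] unfolding A_def by (metis of_nat_le_iff of_nat_power)
      then have "\<mu>\<^sup>2 / 4 * card A \<le> \<mu>\<^sup>2 / 4 * real n ^ (k - 1)" by (intro mult_left_mono) auto
      then show ?thesis by (simp add: field_simps)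
    qed
    finally show ?thesis by (simp add: mult_left_mono)
  qed
  have "real (card (\<Union>K\<in>\<K>. B K)) \<le> (\<Sum>K\<in>\<K>. real (card (B K)))"
    using card_UN_le[OF fin\<K>, of B] by (metis of_nat_le_iff of_nat_sum)
  also have "\<dots> \<le> real (card \<K>) * (real r ^ card A * exp (- \<mu>\<^sup>2 / 4 * real n ^ (k - 1)))"
    using B by (rule sum_bounded_above)
  also have "\<dots> \<le> exp (real n ^ (k - 2)) * (real r ^ card A * exp (- \<mu>\<^sup>2 / 4 * real n ^ (k - 1)))"
    using card\<K> by (intro mult_right_mono) auto
  also have "\<dots> = real r ^ card A * exp (real n ^ (k - 2) * (1 - \<mu>\<^sup>2 / 4 * real n))"
  proof -
    have "k - 1 = Suc (k - 2)" using assms(1) by simp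
    then show ?thesis by (simp add: algebra_simps flip: exp_add)
  qed
  also have "\<dots> < real r ^ card A * 1"
  proof (rule mult_strict_left_mono)
    \<comment> \<open>This is where the threshold \<open>4 / \<mu>\<^sup>2\<close> for
      \<open>n\<close> comes from.\<close>
    have "1 - \<mu>\<^sup>2 / 4 * real n < 0" using assms(4,6) by (simp add: field_simps)
    then show "exp (real n ^ (k - 2) * (1 - \<mu>\<^sup>2 / 4 * real n)) < 1"
      using n by (simp add: mult_pos_neg)
  qed (use assms(2) in simp)
  also have "\<dots> = real (card ?\<Omega>)" using finA by (simp add: card_PiE)
  finally have "card (\<Union>K\<in>\<K>. B K) < card ?\<Omega>" by simp
  then have "\<not> ?\<Omega> \<subseteq> (\<Union>K\<in>\<K>. B K)"
    using card_mono[of "\<Union>K\<in>\<K>. B K" ?\<Omega>] fin\<K> fin by (fastforce simp: B_def)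
  then obtain \<psi> where \<psi>: "\<psi> \<in> ?\<Omega>" "\<And>K. K \<in> \<K> \<Longrightarrow> \<psi> \<notin> B K" by blast
  show thesis
  proof
    show "\<psi> \<in> nsets {1..n} (k - 1) \<rightarrow> {1..r}" using \<psi>(1) by (auto simp: A_def PiE_def)
    show "dense k (real (card P) / real r ^ k) \<mu> (k - 2) (palette_hypergraph k P n \<psi>)"
      unfolding dense_def
    proof (intro allI impI, elim conjE)
      fix G :: "nat hypergraph"
      assume G: "kgraph (k - 2) G" "verts G = verts (palette_hypergraph k P n \<psi>)"
      have V: "verts (palette_hypergraph k P n \<psi>) = {1..n}" by (simp add: palette_hypergraph_def)
      \<comment> \<open>On the fixed vertex set, \<open>G\<close> is determined by its edges, so its
        clique set is one of those that \<open>\<psi>\<close> handles.\<close>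
      have "G = ({1..n}, edges G)" using G(2) V by (metis prod.collapse)
      moreover have "edges G \<subseteq> nsets {1..n} (k - 2)" using G V by (simp add: kgraph_def)
      ultimately have "cliques k (k - 2) G \<in> \<K>" unfolding \<K>_def by (metis PowI image_eqI)
      then have "X (cliques k (k - 2) G) \<psi> \<ge> d * real (card (cliques k (k - 2) G)) - t"
        using \<psi> unfolding B_def by force
      then show "real (card P) / real r ^ k * real (card (cliques k (k - 2) G))
            - \<mu> * real (card (verts (palette_hypergraph k P n \<psi>))) ^ k
          \<le> real (card (cliques k (k - 2) G \<inter> edges (palette_hypergraph k P n \<psi>)))"
        unfolding V by (simp add: X_def d_def t_def)
    qed
  qed
qed

section \<open>Lower bound for the uniform Turan density\<close>

theorem theorem1p10:
  fixes k r :: nat and F :: "'a hypergraph" and P :: "nat list set"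
  assumes "k \<ge> 3"
    and "kgraph k F"
    and "r \<ge> 1"
    and "P \<subseteq> {xs. length xs = k \<and> set xs \<subseteq> {1..r}}"
    and "\<And>n \<psi>. \<psi> \<in> nsets {1..n} (k - 1) \<rightarrow> {1..r} \<Longrightarrow>
           free_of k F (palette_hypergraph k P n \<psi>)"
  shows "uniform_turan_density k (k - 2) F \<ge> real (card P) / real r ^ k"
  unfolding uniform_turan_density_def
\<comment> \<open>The ratio itself belongs to the set whose supremum is taken, and that set is
  bounded above by 1.\<close>
proof (rule cSup_upper)
  let ?d = "real (card P) / real r ^ k"
  have lists: "{xs. length xs = k \<and> set xs \<subseteq> {1..r}} = {xs. set xs \<subseteq> {1..r} \<and> length xs = k}"
    by auto
  have "card P \<le> card {xs. set xs \<subseteq> {1..r} \<and> length xs = k}"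
    using assms(4) unfolding lists by (intro card_mono) (simp_all add: finite_lists_length_eq)
  also have "\<dots> = r ^ k" by (simp add: card_lists_length_eq)
  finally have "real (card P) \<le> real r ^ k" by (metis of_nat_le_iff of_nat_power)
  then have "?d \<le> 1" using assms(3) by simp
  moreover have "\<exists>H :: nat hypergraph.
      kgraph k H \<and> card (verts H) \<ge> n\<^sub>0 \<and> free_of k F H \<and> dense k ?d \<mu> (k - 2) H"
    if "\<mu> > 0" for \<mu> :: real and n\<^sub>0
  proof -
    \<comment> \<open>Capped at 1 to meet the bound on the error parameter; density with the smaller
      error \<open>\<nu>\<close> implies density with \<open>\<mu>\<close>.\<close>
    define \<nu> where "\<nu> = min \<mu> 1"
    have \<nu>: "0 < \<nu>" "\<nu> \<le> 1" "\<nu> \<le> \<mu>" using that by (auto simp: \<nu>_def)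
    obtain N :: nat where N: "real N > 4 / \<nu>\<^sup>2" using reals_Archimedean2 by blast
    define n where "n = max N n\<^sub>0"
    have n: "real n > 4 / \<nu>\<^sup>2" using N by (simp add: n_def)
    have "k \<ge> 2" using assms(1) by simp
    then obtain \<psi> where \<psi>: "\<psi> \<in> nsets {1..n} (k - 1) \<rightarrow> {1..r}"
      and dense: "dense k ?d \<nu> (k - 2) (palette_hypergraph k P n \<psi>)"
      using exists_dense_palette_hypergraph[OF _ assms(3,4) \<nu>(1,2) n] by blast
    let ?H = "palette_hypergraph k P n \<psi>"
    have "\<nu> * real (card (verts ?H)) ^ k \<le> \<mu> * real (card (verts ?H)) ^ k"
      using \<nu> by (intro mult_right_mono) auto
    then have "dense k ?d \<mu> (k - 2) ?H"
      using dense unfolding dense_def by (meson diff_left_mono order_trans)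
    moreover have "kgraph k ?H" "card (verts ?H) \<ge> n\<^sub>0"
      by (auto simp: kgraph_def palette_hypergraph_def n_def)
    ultimately show ?thesis using assms(5)[OF \<psi>] by blast
  qed
  ultimately show "?d \<in> {d. 0 \<le> d \<and> d \<le> 1 \<and>
       (\<forall>\<mu>>0. \<forall>n\<^sub>0. \<exists>H :: nat hypergraph.
          kgraph k H \<and> card (verts H) \<ge> n\<^sub>0 \<and> free_of k F H \<and> dense k d \<mu> (k - 2) H)}"
    by simp
qed (auto intro: bdd_aboveI[of _ 1])

end
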